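(* Let $d\ge 2$ be an integer, let $S>0$ and let $0<c<1$. Then there is no asymmetric hash that is an $(S,cS)$-ALSH for the inner product similarity $\mathrm{sim}(x,y)=x^\top y$ over $\mathcal X=\mathcal Y=\mathbb R^d$.
   Context: An asymmetric hash for a pair of sets $\mathcal X,\mathcal Y$ is a joint probability distribution over pairs of mappings $(f,g)$ with $f:\mathcal X\to\Gamma$ and $g:\mathcal Y\to\Gamma$, where $\Gamma$ is some set (the alphabet). Given $\mathrm{sim}:\mathcal X\times\mathcal Y\to\mathbb R$, an asymmetric hash is an $(S,cS,p_1,p_2)$-ALSH for $\mathrm{sim}$ over $\mathcal X,\mathcal Y$ if for all $x\in\mathcal X$, $y\in\mathcal Y$: (i) if $\mathrm{sim}(x,y)\ge S$ then $\mathbb P_{(f,g)}[f(x)=g(y)]\ge p_1$; (ii) if $\mathrm{sim}(x,y)\le cS$ then $\mathbb P_{(f,g)}[f(x)=g(y)]\le p_2$. It is an $(S,cS)$-ALSH if there exist $p_1,p_2\in[0,1]$ with $p_1>p_2$ such that it is an $(S,cS,p_1,p_2)$-ALSH. *)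

theory Defs
  imports "HOL-Probability.Probability"
begin

text \<open>
  The joint distribution of \<open>(f, g)\<close> is a probability measure \<open>H\<close> on a space of pairs of maps.
  Its sigma-algebra is arbitrary, except that every collision event \<open>f x = g y\<close> has to be
  measurable: otherwise its probability is not defined (and \<^const>\<open>measure\<close> would return 0).
\<close>

definition collision ::
  "(('a \<Rightarrow> 'g) \<times> ('b \<Rightarrow> 'g)) measure \<Rightarrow> 'a \<Rightarrow> 'b \<Rightarrow> (('a \<Rightarrow> 'g) \<times> ('b \<Rightarrow> 'g)) set" where
  "collision H x y = {(f, g) \<in> space H. f x = g y}"

definition asymmetric_hash ::
  "'a set \<Rightarrow> 'b set \<Rightarrow> 'g set \<Rightarrow> (('a \<Rightarrow> 'g) \<times> ('b \<Rightarrow> 'g)) measure \<Rightarrow> bool" where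
  "asymmetric_hash X Y \<Gamma> H \<longleftrightarrow>
     prob_space H \<and>
     space H \<subseteq> (X \<rightarrow> \<Gamma>) \<times> (Y \<rightarrow> \<Gamma>) \<and>
     (\<forall>x\<in>X. \<forall>y\<in>Y. collision H x y \<in> sets H)"

text \<open>The second threshold \<open>T\<close> is the one written \<open>cS\<close> in ``\<open>(S, cS)\<close>-ALSH''.\<close>

definition ALSH_with ::
  "'a set \<Rightarrow> 'b set \<Rightarrow> ('a \<Rightarrow> 'b \<Rightarrow> real) \<Rightarrow> real \<Rightarrow> real \<Rightarrow> real \<Rightarrow> real \<Rightarrow>
   (('a \<Rightarrow> 'g) \<times> ('b \<Rightarrow> 'g)) measure \<Rightarrow> bool" where
  "ALSH_with X Y sim S T p1 p2 H \<longleftrightarrow>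
     (\<forall>x\<in>X. \<forall>y\<in>Y.
        (S \<le> sim x y \<longrightarrow> p1 \<le> measure H (collision H x y)) \<and>
        (sim x y \<le> T \<longrightarrow> measure H (collision H x y) \<le> p2))"

definition ALSH ::
  "'a set \<Rightarrow> 'b set \<Rightarrow> ('a \<Rightarrow> 'b \<Rightarrow> real) \<Rightarrow> real \<Rightarrow> real \<Rightarrow>
   (('a \<Rightarrow> 'g) \<times> ('b \<Rightarrow> 'g)) measure \<Rightarrow> bool" where
  "ALSH X Y sim S T H \<longleftrightarrow>
     (\<exists>p1\<in>{0..1}. \<exists>p2\<in>{0..1}. p2 < p1 \<and> ALSH_with X Y sim S T p1 p2 H)"

end

theory Submission
  imports Defs
begin

text \<open>
  The vectors \<open>x i = (1, i)\<close> and \<open>y j = (S + (1 - c) S j, - (1 - c) S)\<close> satisfy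
  \<open>x i \<bullet> y j = S + (1 - c) S (j - i)\<close>, so a hash with gap \<open>\<delta> = p1 - p2 > 0\<close> gives
  collision probabilities \<open>P i j\<close> that are at least \<open>p1\<close> for \<open>i \<le> j\<close> and at most \<open>p2\<close> for
  \<open>i > j\<close>. Let \<open>K i k\<close> be the probability that \<open>x i\<close> and \<open>x k\<close> both collide with a common \<open>y j\<close>,
  and \<open>Q\<close> its quadratic form. Sharing a hash value is transitive, whence
  \<open>(\<Sum>i. w i * P i j)\<^sup>2 \<le> Q w\<close>. If \<open>u\<close> and \<open>v\<close> are the uniform distributions on two
  adjacent blocks of indices and \<open>j\<close> is the last index of the first block, this yields
  \<open>Q (u - v) \<ge> \<delta>\<^sup>2\<close>, and by the parallelogram law \<open>Q ((u + v) / 2)\<close> is smaller than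
  the mean of \<open>Q u\<close> and \<open>Q v\<close> by at least \<open>\<delta>\<^sup>2 / 4\<close>. Doubling the blocks repeatedly makes \<open>Q\<close>
  negative, which is impossible.
\<close>

definition quad :: "('i \<Rightarrow> 'i \<Rightarrow> real) \<Rightarrow> 'i set \<Rightarrow> ('i \<Rightarrow> real) \<Rightarrow> real" where
  "quad K I w = (\<Sum>i\<in>I. \<Sum>k\<in>I. w i * w k * K i k)"

lemma quad_midpoint:
  "quad K I (\<lambda>i. (u i + v i) / 2) =
     (quad K I u + quad K I v) / 2 - quad K I (\<lambda>i. u i - v i) / 4"
  unfolding quad_def
  by (simp only: sum_divide_distrib sum_subtractf [symmetric] sum.distrib [symmetric])
    (intro sum.cong refl, simp add: field_simps)

lemma class_weight_square_le_quad:
  assumes "finite J" "j \<in> J"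
  shows "(\<Sum>i\<in>I. w i * of_bool (f i = g j))\<^sup>2
    \<le> quad (\<lambda>i k. of_bool (\<exists>j\<in>J. f i = g j \<and> f k = g j)) I w"
proof -
  let ?W = "\<lambda>\<gamma>. \<Sum>i\<in>I. w i * of_bool (f i = \<gamma>) :: real"
  have "of_bool (\<exists>j\<in>J. f i = g j \<and> f k = g j)
      = (\<Sum>\<gamma>\<in>g ` J. of_bool (f i = \<gamma>) * of_bool (f k = \<gamma>) :: real)" for i k
  proof (cases "f i \<in> g ` J")
    case True
    then have "(\<Sum>\<gamma>\<in>g ` J. of_bool (f i = \<gamma>) * of_bool (f k = \<gamma>))
        = (\<Sum>\<gamma>\<in>g ` J. if \<gamma> = f i then of_bool (f k = f i) else 0 :: real)"
      by (intro sum.cong) auto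
    with True show ?thesis
      using assms(1) by (auto simp: sum.delta)
  next
    case False
    then show ?thesis
      by (auto intro!: sum.neutral)
  qed
  then have "quad (\<lambda>i k. of_bool (\<exists>j\<in>J. f i = g j \<and> f k = g j)) I w
      = (\<Sum>i\<in>I. \<Sum>k\<in>I. \<Sum>\<gamma>\<in>g ` J. (w i * of_bool (f i = \<gamma>)) * (w k * of_bool (f k = \<gamma>)))"
    unfolding quad_def by (simp only: sum_distrib_left mult_ac)
  also have "\<dots> = (\<Sum>i\<in>I. \<Sum>\<gamma>\<in>g ` J. \<Sum>k\<in>I. (w i * of_bool (f i = \<gamma>)) * (w k * of_bool (f k = \<gamma>)))"
    by (intro sum.cong refl sum.swap)
  also have "\<dots> = (\<Sum>\<gamma>\<in>g ` J. \<Sum>i\<in>I. \<Sum>k\<in>I. (w i * of_bool (f i = \<gamma>)) * (w k * of_bool (f k = \<gamma>)))"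
    by (rule sum.swap)
  also have "\<dots> = (\<Sum>\<gamma>\<in>g ` J. (?W \<gamma>)\<^sup>2)"
    by (simp only: power2_eq_square sum_product)
  finally show ?thesis
    using member_le_sum [of "g j" "g ` J" "\<lambda>\<gamma>. (?W \<gamma>)\<^sup>2"] assms by simp
qed

text \<open>The inequality for fixed maps holds at every outcome. Taking expectations turns
  indicators into probabilities, and nonnegative variance moves the square outside.\<close>

lemma (in prob_space) collision_square_le_quad:
  fixes x :: "'i \<Rightarrow> 'x" and y :: "'j \<Rightarrow> 'y"
  assumes I: "finite I" and J: "finite J" "j \<in> J"
    and C: "\<And>i j. i \<in> I \<Longrightarrow> j \<in> J \<Longrightarrow> {\<omega> \<in> space M. f \<omega> (x i) = g \<omega> (y j)} \<in> events"
  shows "(\<Sum>i\<in>I. w i * prob {\<omega> \<in> space M. f \<omega> (x i) = g \<omega> (y j)})\<^sup>2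
    \<le> quad (\<lambda>i k. prob {\<omega> \<in> space M. \<exists>j\<in>J. f \<omega> (x i) = g \<omega> (y j) \<and> f \<omega> (x k) = g \<omega> (y j)}) I w"
proof -
  let ?C = "\<lambda>i. {\<omega> \<in> space M. f \<omega> (x i) = g \<omega> (y j)}"
  let ?D = "\<lambda>i k. {\<omega> \<in> space M. \<exists>j\<in>J. f \<omega> (x i) = g \<omega> (y j) \<and> f \<omega> (x k) = g \<omega> (y j)}"
  let ?X = "\<lambda>\<omega>. \<Sum>i\<in>I. w i * indicator (?C i) \<omega>"
  let ?Y = "\<lambda>\<omega>. \<Sum>i\<in>I. \<Sum>k\<in>I. w i * w k * indicator (?D i k) \<omega>"
  have D: "?D i k \<in> events" if "i \<in> I" "k \<in> I" for i k
  proof -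
    have "?D i k = (\<Union>j\<in>J. {\<omega> \<in> space M. f \<omega> (x i) = g \<omega> (y j)} \<inter> {\<omega> \<in> space M. f \<omega> (x k) = g \<omega> (y j)})"
      by auto
    with J(1) C that show ?thesis
      by auto
  qed
  have intC: "integrable M (indicator (?C i) :: _ \<Rightarrow> real)" if "i \<in> I" for i
    using C [OF that J(2)] by (auto simp: integrable_indicator_iff emeasure_eq_measure)
  have intD: "integrable M (indicator (?D i k) :: _ \<Rightarrow> real)" if "i \<in> I" "k \<in> I" for i k
    using D [OF that] by (auto simp: integrable_indicator_iff emeasure_eq_measure)
  have le: "(?X \<omega>)\<^sup>2 \<le> ?Y \<omega>" if "\<omega> \<in> space M" for \<omega>
    using class_weight_square_le_quad [OF J,
        where I = I and w = w and f = "\<lambda>i. f \<omega> (x i)" and g = "\<lambda>j. g \<omega> (y j)"] that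
    by (simp add: quad_def indicator_def)
  have X: "integrable M ?X"
    using intC by auto
  have Y: "integrable M ?Y"
    using intD by auto
  have X2: "integrable M (\<lambda>\<omega>. (?X \<omega>)\<^sup>2)"
    by (rule Bochner_Integration.integrable_bound [OF Y])
      (use X in measurable, use le in \<open>auto intro: order_trans [OF _ abs_ge_self]\<close>)
  have "(expectation ?X)\<^sup>2 \<le> expectation (\<lambda>\<omega>. (?X \<omega>)\<^sup>2)"
    using variance_positive [of ?X] variance_eq [OF X X2] by simp
  also have "\<dots> \<le> expectation ?Y"
    using X2 Y le by (rule integral_mono)
  also have "expectation ?Y = quad (\<lambda>i k. prob (?D i k)) I w"
    using intD D by (simp add: quad_def)
  also have "expectation ?X = (\<Sum>i\<in>I. w i * prob (?C i))"
    using intC C J(2) by simp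
  finally show ?thesis .
qed

text \<open>Induction on \<open>r\<close>, with \<open>s\<close> arbitrary because both halves of a
  doubled block need the hypothesis, at different starting points. Point masses start the
  induction.\<close>

lemma block_weights_quad_le:
  fixes K P :: "nat \<Rightarrow> nat \<Rightarrow> real"
  assumes sq: "\<And>w j. j < n \<Longrightarrow> (\<Sum>i<n. w i * P i j)\<^sup>2 \<le> quad K {..<n} w"
    and diag: "\<And>i. K i i \<le> 1"
    and hi: "\<And>i j. i \<le> j \<Longrightarrow> p1 \<le> P i j"
    and lo: "\<And>i j. j < i \<Longrightarrow> P i j \<le> p2"
    and "p2 \<le> p1" and "s + 2 ^ r \<le> n"
  shows "\<exists>w. (\<forall>i. 0 \<le> w i) \<and> (\<forall>i. w i \<noteq> 0 \<longrightarrow> i \<in> {s..<s + 2 ^ r}) \<and> sum w {..<n} = 1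
    \<and> quad K {..<n} w \<le> 1 - r * (p1 - p2)\<^sup>2 / 4"
  using \<open>s + 2 ^ r \<le> n\<close>
proof (induction r arbitrary: s)
  case 0
  have "quad K {..<n} (\<lambda>i. of_bool (i = s)) = K s s"
    using 0 by (simp add: quad_def mult.assoc sum_distrib_left [symmetric])
  then have "quad K {..<n} (\<lambda>i. of_bool (i = s)) \<le> 1"
    using diag by simp
  moreover have "(\<Sum>i<n. of_bool (i = s)) = (1 :: real)"
    using 0 by (simp add: of_bool_def)
  ultimately show ?case
    by (intro exI [of _ "\<lambda>i. of_bool (i = s)"]) auto
next
  case (Suc r)
  let ?m = "s + 2 ^ r"
  from Suc.prems have "?m \<le> n" "?m + 2 ^ r \<le> n"
    by auto
  from Suc.IH [OF this(1)] Suc.IH [OF this(2)] obtain u v where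
    u: "\<And>i. 0 \<le> u i" "\<And>i. u i \<noteq> 0 \<Longrightarrow> i \<in> {s..<?m}" "sum u {..<n} = 1"
       "quad K {..<n} u \<le> 1 - r * (p1 - p2)\<^sup>2 / 4" and
    v: "\<And>i. 0 \<le> v i" "\<And>i. v i \<noteq> 0 \<Longrightarrow> i \<in> {?m..<?m + 2 ^ r}" "sum v {..<n} = 1"
       "quad K {..<n} v \<le> 1 - r * (p1 - p2)\<^sup>2 / 4"
    by metis
  \<comment> \<open>The subtraction does not truncate, as \<open>2 ^ r\<close> is positive. Thus
    \<open>hi\<close> applies on the support of \<open>u\<close> and \<open>lo\<close> on that of
    \<open>v\<close>.\<close>
  define j where "j = ?m - 1"
  have j: "Suc j = ?m"
    by (simp add: j_def)
  have "p1 * sum u {..<n} \<le> (\<Sum>i<n. u i * P i j)"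
    unfolding sum_distrib_left
  proof (rule sum_mono)
    fix i
    show "p1 * u i \<le> u i * P i j"
      using u(1) [of i] u(2) [of i] hi [of i j] j
      by (cases "u i = 0") (auto simp: mult.commute intro: mult_left_mono)
  qed
  moreover have "(\<Sum>i<n. v i * P i j) \<le> p2 * sum v {..<n}"
    unfolding sum_distrib_left
  proof (rule sum_mono)
    fix i
    show "v i * P i j \<le> p2 * v i"
      using v(1) [of i] v(2) [of i] lo [of j i] j
      by (cases "v i = 0") (auto simp: mult.commute intro: mult_left_mono)
  qed
  ultimately have "p1 - p2 \<le> (\<Sum>i<n. (u i - v i) * P i j)"
    using u(3) v(3) by (simp add: left_diff_distrib sum_subtractf)
  then have "(p1 - p2)\<^sup>2 \<le> (\<Sum>i<n. (u i - v i) * P i j)\<^sup>2"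
    using \<open>p2 \<le> p1\<close> by (intro power_mono) auto
  also have "\<dots> \<le> quad K {..<n} (\<lambda>i. u i - v i)"
    using \<open>?m \<le> n\<close> j by (intro sq) auto
  finally have "quad K {..<n} (\<lambda>i. (u i + v i) / 2) \<le> 1 - Suc r * (p1 - p2)\<^sup>2 / 4"
    using u(4) v(4) by (simp add: quad_midpoint field_simps)
  moreover have "(\<Sum>i<n. (u i + v i) / 2) = 1"
    using u(3) v(3) by (simp add: sum_divide_distrib [symmetric] sum.distrib)
  moreover have "i \<in> {s..<s + 2 ^ Suc r}" if "(u i + v i) / 2 \<noteq> 0" for i
    using that u(2) [of i] v(2) [of i] by (cases "u i = 0") auto
  ultimately show ?case
    using u(1) v(1) by (intro exI [of _ "\<lambda>i. (u i + v i) / 2"]) auto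
qed

lemma (in prob_space) collision_threshold_gap:
  fixes x :: "nat \<Rightarrow> 'x" and y :: "nat \<Rightarrow> 'y"
  assumes C: "\<And>i j. {\<omega> \<in> space M. f \<omega> (x i) = g \<omega> (y j)} \<in> events"
    and hi: "\<And>i j. i \<le> j \<Longrightarrow> p1 \<le> prob {\<omega> \<in> space M. f \<omega> (x i) = g \<omega> (y j)}"
    and lo: "\<And>i j. j < i \<Longrightarrow> prob {\<omega> \<in> space M. f \<omega> (x i) = g \<omega> (y j)} \<le> p2"
  shows "p1 \<le> p2"
proof (rule ccontr)
  assume "\<not> p1 \<le> p2"
  then have "0 < (p1 - p2)\<^sup>2 / 4"
    by simp
  \<comment> \<open>After this many doublings the bound on the form drops below 0.\<close>
  then obtain r :: nat where r: "1 < r * ((p1 - p2)\<^sup>2 / 4)"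
    using reals_Archimedean3 by blast
  define n :: nat where "n = 2 ^ r"
  let ?P = "\<lambda>i j. prob {\<omega> \<in> space M. f \<omega> (x i) = g \<omega> (y j)}"
  let ?K = "\<lambda>i k. prob {\<omega> \<in> space M. \<exists>j\<in>{..<n}. f \<omega> (x i) = g \<omega> (y j) \<and> f \<omega> (x k) = g \<omega> (y j)}"
  have sq: "(\<Sum>i<n. w i * ?P i j)\<^sup>2 \<le> quad ?K {..<n} w" if "j < n" for w j
    using that by (intro collision_square_le_quad C) auto
  have "\<exists>w. (\<forall>i. 0 \<le> w i) \<and> (\<forall>i. w i \<noteq> 0 \<longrightarrow> i \<in> {0..<0 + 2 ^ r}) \<and> sum w {..<n} = 1
      \<and> quad ?K {..<n} w \<le> 1 - r * (p1 - p2)\<^sup>2 / 4"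
    using \<open>\<not> p1 \<le> p2\<close>
    by (intro block_weights_quad_le [where P = ?P] sq hi lo) (auto simp: n_def)
  then obtain w where "quad ?K {..<n} w \<le> 1 - r * (p1 - p2)\<^sup>2 / 4"
    by blast
  \<comment> \<open>The form is nonnegative because by \<open>sq\<close> it dominates a square;
    index 0 is available since \<open>n\<close> is positive.\<close>
  moreover have "0 \<le> quad ?K {..<n} w"
    by (rule order_trans [OF zero_le_power2 sq [of 0]]) (simp add: n_def)
  ultimately show False
    using r by simp
qed

theorem theorem3p1:
  fixes S c :: real
  assumes "2 \<le> CARD('d::finite)"
    and "0 < S"
    and "0 < c"
    and "c < 1"
  shows "\<not> (\<exists>(\<Gamma> :: 'g set) (H :: ((real ^ 'd \<Rightarrow> 'g) \<times> (real ^ 'd \<Rightarrow> 'g)) measure).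
    asymmetric_hash UNIV UNIV \<Gamma> H \<and>
    ALSH UNIV UNIV (\<lambda>x y. x \<bullet> y) S (c * S) H)"
proof
  assume "\<exists>(\<Gamma> :: 'g set) (H :: ((real ^ 'd \<Rightarrow> 'g) \<times> (real ^ 'd \<Rightarrow> 'g)) measure).
    asymmetric_hash UNIV UNIV \<Gamma> H \<and> ALSH UNIV UNIV (\<lambda>x y. x \<bullet> y) S (c * S) H"
  then obtain H :: "((real ^ 'd \<Rightarrow> 'g) \<times> (real ^ 'd \<Rightarrow> 'g)) measure" and p1 p2
    where "prob_space H"
      and meas: "\<And>x y. collision H x y \<in> sets H"
      and "p2 < p1"
      and hi: "\<And>x y. S \<le> x \<bullet> y \<Longrightarrow> p1 \<le> measure H (collision H x y)"
      and lo: "\<And>x y. x \<bullet> y \<le> c * S \<Longrightarrow> measure H (collision H x y) \<le> p2"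
    unfolding asymmetric_hash_def ALSH_def ALSH_with_def by auto
  interpret prob_space H
    by fact
  \<comment> \<open>Dimension at least 2 supplies the two coordinates that carry the
    vectors.\<close>
  obtain a b :: 'd where "a \<noteq> b"
    using assms(1) by (metis card_2_iff' card_le_Suc0_iff_eq finite not_less_eq_eq numeral_2_eq_2 UNIV_I)
  define x :: "nat \<Rightarrow> real ^ 'd" where "x i = axis a 1 + axis b (real i)" for i
  define y :: "nat \<Rightarrow> real ^ 'd"
    where "y j = axis a (S + (1 - c) * S * real j) + axis b (- ((1 - c) * S))" for j
  have xy: "x i \<bullet> y j = S + (1 - c) * S * (real j - real i)" for i j
    using \<open>a \<noteq> b\<close> by (simp add: x_def y_def inner_add inner_axis_axis algebra_simps)
  have coll: "{\<omega> \<in> space H. fst \<omega> (x i) = snd \<omega> (y j)} = collision H (x i) (y j)" for i j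
    by (auto simp: collision_def)
  have pos: "0 < (1 - c) * S"
    using assms by simp
  have "p1 \<le> p2"
  proof (rule collision_threshold_gap [of fst x snd y], unfold coll)
    fix i j :: nat
    show "collision H (x i) (y j) \<in> events"
      by (rule meas)
    show "p1 \<le> prob (collision H (x i) (y j))" if "i \<le> j"
      using that pos by (intro hi) (simp add: xy)
    show "prob (collision H (x i) (y j)) \<le> p2" if "j < i"
    proof (rule lo)
      \<comment> \<open>Integer indices with \<open>j < i\<close> differ by at least 1, and one step
        of \<open>(1 - c) * S\<close> takes \<open>S\<close> down exactly to
        \<open>c * S\<close>.\<close>
      have "(1 - c) * S * (real j - real i) \<le> (1 - c) * S * (- 1)"
        using that pos by (intro mult_left_mono) auto
      then show "x i \<bullet> y j \<le> c * S"
        by (simp add: xy algebra_simps)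
    qed
  qed
  with \<open>p2 < p1\<close> show False
    by simp
qed

end
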